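(* Assume A1 and A2 (stated in the context). If $x\in B_\rho(x_0)$, then $$0\ \ge\ (1-\eta)\|F_0(x)\|^2+\langle F'(x)^*F_0(x),\,x^\star-x\rangle\qquad\text{for all }x^\star\in B_\rho(x_0)\cap F^{-1}(y).$$ Consequently, with $$H_x:=\{z\in X:\ \langle z-x,\,F'(x)^*F_0(x)\rangle\le-(1-\eta)\|F_0(x)\|^2\},$$ one has: (1) $B_\rho(x_0)\cap F^{-1}(y)\subset H_x$; and (2) $x\in H_x$ if and only if $F(x)=y$.
   Context: $X,Y$ are real Hilbert spaces, $F:D(F)\subset X\to Y$ is a (nonlinear) operator, $y\in Y$, $F_0(x):=F(x)-y$, and $F^{-1}(y)=\{x\in D(F):F(x)=y\}$. $B_r(z)$ denotes the open ball of radius $r$ centered at $z$ in $X$. A1: $F$ is continuous on $D(F)$, which has nonempty interior; there are constants $C,\rho>0$ and $x_0\in D(F)$ with $B_\rho(x_0)\subset D(F)$ such that the Gateaux derivative $F'(x)$ (a bounded linear operator $X\to Y$) exists for $x\in B_\rho(x_0)$ and $\|F'(x)\|\le C$ there. A2 (tangential cone condition): there is a constant $\eta\in[0,1)$ such that $\|F(\bar x)-F(x)-F'(x)(\bar x-x)\|\le\eta\|F(\bar x)-F(x)\|$ for all $x,\bar x\in B_\rho(x_0)$. *)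

theory Defs
  imports "HOL-Analysis.Analysis"
begin

text \<open>A partially defined operator is a total function together with its domain \<open>D\<close>. The Gateaux
  derivative is only taken at interior points of \<open>D\<close>, where the difference quotient depends, for
  small \<open>t\<close>, on the values of \<open>F\<close> on \<open>D\<close> alone.\<close>

definition has_gateaux_derivative ::
  "('a::real_normed_vector \<Rightarrow> 'b::real_normed_vector) \<Rightarrow> ('a \<Rightarrow>\<^sub>L 'b) \<Rightarrow> 'a \<Rightarrow> bool"
  where "has_gateaux_derivative F L x \<longleftrightarrow>
    (\<forall>h. ((\<lambda>t::real. (F (x + t *\<^sub>R h) - F x) /\<^sub>R t) \<longlongrightarrow> blinfun_apply L h) (at 0))"

definition assumption_A1 ::
  "'a::{real_inner,complete_space} set \<Rightarrow> ('a \<Rightarrow> 'b::{real_inner,complete_space}) \<Rightarrow>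
    ('a \<Rightarrow> 'a \<Rightarrow>\<^sub>L 'b) \<Rightarrow> 'a \<Rightarrow> real \<Rightarrow> real \<Rightarrow> bool"
  where "assumption_A1 D F F' x\<^sub>0 \<rho> C \<longleftrightarrow>
    continuous_on D F \<and> interior D \<noteq> {} \<and> C > 0 \<and> \<rho> > 0 \<and> x\<^sub>0 \<in> D \<and> ball x\<^sub>0 \<rho> \<subseteq> D \<and>
    (\<forall>x\<in>ball x\<^sub>0 \<rho>. has_gateaux_derivative F (F' x) x \<and> norm (F' x) \<le> C)"

definition assumption_A2 ::
  "('a::{real_inner,complete_space} \<Rightarrow> 'b::{real_inner,complete_space}) \<Rightarrow>
    ('a \<Rightarrow> 'a \<Rightarrow>\<^sub>L 'b) \<Rightarrow> 'a \<Rightarrow> real \<Rightarrow> real \<Rightarrow> bool"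
  where "assumption_A2 F F' x\<^sub>0 \<rho> \<eta> \<longleftrightarrow>
    0 \<le> \<eta> \<and> \<eta> < 1 \<and>
    (\<forall>x\<in>ball x\<^sub>0 \<rho>. \<forall>x'\<in>ball x\<^sub>0 \<rho>.
      norm (F x' - F x - blinfun_apply (F' x) (x' - x)) \<le> \<eta> * norm (F x' - F x))"

definition residual :: "('a \<Rightarrow> 'b::real_inner) \<Rightarrow> 'b \<Rightarrow> 'a \<Rightarrow> 'b"
  where "residual F y x = F x - y"

definition solution_set :: "'a set \<Rightarrow> ('a \<Rightarrow> 'b) \<Rightarrow> 'b \<Rightarrow> 'a set"
  where "solution_set D F y = {x \<in> D. F x = y}"

text \<open>The library's \<^const>\<open>adjoint\<close> is a choice of a map with the defining identity of the adjoint;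
  for a bounded operator on a Hilbert space such a map exists (Riesz) and is unique.\<close>

definition separating_halfspace ::
  "('a::{real_inner,complete_space} \<Rightarrow> 'b::{real_inner,complete_space}) \<Rightarrow>
    ('a \<Rightarrow> 'a \<Rightarrow>\<^sub>L 'b) \<Rightarrow> 'b \<Rightarrow> real \<Rightarrow> 'a \<Rightarrow> 'a set"
  where "separating_halfspace F F' y \<eta> x =
    {z. (z - x) \<bullet> adjoint (blinfun_apply (F' x)) (residual F y x)
          \<le> - (1 - \<eta>) * (norm (residual F y x))\<^sup>2}"

end

theory Submission imports Defs begin

text \<open>Testing the cone condition at a solution against the residual and applying Cauchy-Schwarz gives
  the inequality, once the derivative is moved across the inner product. As the library has the
  adjoint identity only for Euclidean spaces, existence of the adjoint is derived from the Riesz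
  representation theorem, whose proof minimises \<open>\<parallel>u\<parallel>\<^sup>2 / 2 - \<phi> u\<close>.\<close>

lemma riesz_representation:
  fixes \<phi> :: "'a::{real_inner,complete_space} \<Rightarrow> real"
  assumes "bounded_linear \<phi>"
  obtains u where "\<And>h. \<phi> h = h \<bullet> u"
proof -
  interpret bounded_linear \<phi> by fact
  define J where "J v = (norm v)\<^sup>2 / 2 - \<phi> v" for v
  define m where "m = (INF v. J v)"
  obtain K where K: "\<And>v. norm (\<phi> v) \<le> norm v * K"
    using bounded by blast
  \<comment> \<open>Completing the square: \<open>J v\<close> is at least
    \<open>((norm v - K)\<^sup>2 - K\<^sup>2) / 2\<close>, whatever the sign of
    \<open>K\<close>.\<close>
  have "- K\<^sup>2 / 2 \<le> J v" for v
  proof -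
    have "0 \<le> (norm v - K)\<^sup>2" by simp
    moreover have "\<phi> v \<le> norm v * K"
      using K[of v] by simp
    ultimately show ?thesis
      unfolding J_def power2_diff by (simp add: field_simps)
  qed
  then have bdd: "bdd_below (range J)"
    by (intro bdd_belowI) auto
  then have m_le: "m \<le> J v" for v
    unfolding m_def by (intro cINF_lower) auto
  have "\<exists>v. J v < m + 1 / real (Suc n)" for n
    using cINF_less_iff[of UNIV J "m + 1 / real (Suc n)"] bdd by (auto simp: m_def)
  then obtain s where s: "\<And>n. J (s n) < m + 1 / real (Suc n)"
    by metis
  \<comment> \<open>The linear part of \<open>J\<close> cancels in the midpoint defect, leaving the
    parallelogram law; the midpoint value is then replaced by its lower bound \<open>m\<close>.
    Hence near-minimisers lie close together.\<close>
  have parallelogram: "(norm (a - b))\<^sup>2 \<le> 4 * (J a + J b - 2 * m)" for a b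
  proof -
    have "(norm (a - b))\<^sup>2 = 4 * (J a + J b - 2 * J ((a + b) /\<^sub>R 2))"
      by (simp add: J_def power2_norm_eq_inner inner_simps inner_commute add scaleR algebra_simps)
    with m_le[of "(a + b) /\<^sub>R 2"] show ?thesis by simp
  qed
  have "Cauchy s"
  proof (rule metric_CauchyI)
    fix e :: real assume "e > 0"
    \<comment> \<open>The 8 absorbs the factor 4 of \<open>parallelogram\<close> and the two
      excesses over \<open>m\<close>.\<close>
    then obtain N where N: "1 / real (Suc N) < e\<^sup>2 / 8"
      using nat_approx_posE[of "e\<^sup>2 / 8"] by auto
    have J_small: "J (s n) < m + e\<^sup>2 / 8" if "n \<ge> N" for n
    proof -
      have "1 / real (Suc n) \<le> 1 / real (Suc N)"
        using that by (simp add: frac_le)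
      with N s[of n] show ?thesis by linarith
    qed
    have "dist (s i) (s j) < e" if "i \<ge> N" "j \<ge> N" for i j
    proof -
      have "(norm (s i - s j))\<^sup>2 < e\<^sup>2"
        using parallelogram[of "s i" "s j"] J_small[OF that(1)] J_small[OF that(2)] by argo
      then show ?thesis
        using \<open>e > 0\<close> by (simp add: dist_norm power_less_imp_less_base)
    qed
    then show "\<exists>N. \<forall>i\<ge>N. \<forall>j\<ge>N. dist (s i) (s j) < e" by blast
  qed
  then obtain u where u: "s \<longlonglongrightarrow> u"
    using Cauchy_convergent convergent_def by blast
  have "(\<lambda>n. J (s n)) \<longlonglongrightarrow> J u"
    unfolding J_def by (intro tendsto_intros tendsto u) simp
  moreover have "(\<lambda>n. m + 1 / real (Suc n)) \<longlonglongrightarrow> m + 0"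
    by (intro tendsto_intros LIMSEQ_Suc lim_1_over_n)
  \<comment> \<open>The limit of the minimising sequence attains the infimum, by continuity of
    \<open>J\<close>.\<close>
  ultimately have "J u \<le> m + 0"
    using s by (intro LIMSEQ_le[of "\<lambda>n. J (s n)"]) (auto intro: less_imp_le)
  then have u_min: "J u \<le> J v" for v
    using m_le[of v] by simp
  have "\<phi> h = h \<bullet> u" for h
  proof (rule ccontr)
    assume neq: "\<phi> h \<noteq> h \<bullet> u"
    define c where "c = h \<bullet> u - \<phi> h"
    have "h \<noteq> 0" using neq zero by auto
    have "c \<noteq> 0" using neq by (simp add: c_def)
    \<comment> \<open>Here \<open>c\<close> is the directional derivative of \<open>J\<close> at
      \<open>u\<close> along \<open>h\<close>, and this \<open>t\<close> minimises the quadratic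
      \<open>t * c + t\<^sup>2 * (h \<bullet> h) / 2\<close>, so a nonzero \<open>c\<close> would
      push \<open>J\<close> strictly below its minimum.\<close>
    define t where "t = - c / (h \<bullet> h)"
    have "J (u + t *\<^sub>R h) = J u + t * c + t\<^sup>2 * (h \<bullet> h) / 2"
      unfolding J_def c_def power2_norm_eq_inner
      by (simp add: inner_simps inner_commute add scaleR power2_eq_square algebra_simps)
    also have "\<dots> = J u - c\<^sup>2 / (2 * (h \<bullet> h))"
      using \<open>h \<noteq> 0\<close> by (simp add: t_def power2_eq_square field_simps)
    also have "\<dots> < J u"
      using \<open>h \<noteq> 0\<close> \<open>c \<noteq> 0\<close> by simp
    finally show False using u_min[of "u + t *\<^sub>R h"] by simp
  qed
  then show thesis by (rule that)
qed

text \<open>Since \<open>adjoint\<close> is a Hilbert choice, its identity holds as soon as one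
  witness exists. Representing the functional \<open>f x \<bullet> y\<close> of \<open>x\<close> for
  each fixed \<open>y\<close> supplies one; no linearity in \<open>y\<close> has to be
  shown.\<close>

lemma adjoint_works_bounded:
  fixes f :: "'a::{real_inner,complete_space} \<Rightarrow> 'b::real_inner"
  assumes "bounded_linear f"
  shows "x \<bullet> adjoint f y = f x \<bullet> y"
proof -
  have "\<exists>u. \<forall>x. f x \<bullet> y = x \<bullet> u" for y
    using riesz_representation[OF bounded_linear_compose[OF bounded_linear_inner_left assms]]
    by metis
  then have "\<exists>f'. \<forall>x y. f x \<bullet> y = x \<bullet> f' y"
    by metis
  then have "\<forall>x y. f x \<bullet> y = x \<bullet> adjoint f y"
    unfolding adjoint_def by (rule someI_ex)
  then show ?thesis by simp
qed

theorem lemma3p1: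
  fixes D :: "'a::{real_inner,complete_space} set"
    and F :: "'a \<Rightarrow> 'b::{real_inner,complete_space}"
    and F' :: "'a \<Rightarrow> 'a \<Rightarrow>\<^sub>L 'b"
    and x\<^sub>0 x :: 'a and y :: 'b and \<rho> C \<eta> :: real
  assumes "assumption_A1 D F F' x\<^sub>0 \<rho> C"
    and "assumption_A2 F F' x\<^sub>0 \<rho> \<eta>"
    and "x \<in> ball x\<^sub>0 \<rho>"
  shows "(\<forall>x' \<in> ball x\<^sub>0 \<rho> \<inter> solution_set D F y.
            0 \<ge> (1 - \<eta>) * (norm (residual F y x))\<^sup>2
                + adjoint (blinfun_apply (F' x)) (residual F y x) \<bullet> (x' - x))
       \<and> ball x\<^sub>0 \<rho> \<inter> solution_set D F y \<subseteq> separating_halfspace F F' y \<eta> x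
       \<and> (x \<in> separating_halfspace F F' y \<eta> x \<longleftrightarrow> F x = y)"
proof -
  let ?r = "residual F y x" and ?A = "blinfun_apply (F' x)"
  have \<eta>: "\<eta> < 1"
    using assms(2) by (simp add: assumption_A2_def)
  have ineq: "(1 - \<eta>) * (norm ?r)\<^sup>2 + adjoint ?A ?r \<bullet> (x' - x) \<le> 0"
    if "x' \<in> ball x\<^sub>0 \<rho> \<inter> solution_set D F y" for x'
  proof -
    let ?d = "x' - x"
    have "norm (F x' - F x - ?A ?d) \<le> \<eta> * norm (F x' - F x)"
      using assms(2,3) that by (auto simp: assumption_A2_def)
    moreover have "F x' = y"
      using that by (simp add: solution_set_def)
    \<comment> \<open>At a solution \<open>F x' - F x\<close> is minus the residual, so the cone
      condition only involves \<open>?r\<close> and \<open>?A ?d\<close>.\<close>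
    ultimately have "norm (- (?r + ?A ?d)) \<le> \<eta> * norm (- ?r)"
      by (simp add: residual_def algebra_simps)
    then have cone: "norm (?r + ?A ?d) \<le> \<eta> * norm ?r"
      unfolding norm_minus_cancel .
    have "(?r + ?A ?d) \<bullet> ?r \<le> norm (?r + ?A ?d) * norm ?r"
      by (rule norm_cauchy_schwarz)
    also have "\<dots> \<le> \<eta> * norm ?r * norm ?r"
      by (rule mult_right_mono[OF cone norm_ge_zero])
    finally have "(norm ?r)\<^sup>2 + ?A ?d \<bullet> ?r \<le> \<eta> * (norm ?r)\<^sup>2"
      by (simp add: inner_add_left power2_norm_eq_inner[symmetric] power2_eq_square mult.assoc)
    moreover have "adjoint ?A ?r \<bullet> ?d = ?A ?d \<bullet> ?r"
      by (simp add: inner_commute[of "adjoint ?A ?r"] adjoint_works_bounded blinfun.bounded_linear_right)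
    ultimately show ?thesis
      by (simp add: algebra_simps)
  qed
  have "ball x\<^sub>0 \<rho> \<inter> solution_set D F y \<subseteq> separating_halfspace F F' y \<eta> x"
  proof
    fix z assume "z \<in> ball x\<^sub>0 \<rho> \<inter> solution_set D F y"
    from ineq[OF this] show "z \<in> separating_halfspace F F' y \<eta> x"
      unfolding separating_halfspace_def mem_Collect_eq mult_minus_left
      by (subst inner_commute) linarith
  qed
  moreover have "x \<in> separating_halfspace F F' y \<eta> x \<longleftrightarrow> F x = y"
  proof -
    \<comment> \<open>At \<open>z = x\<close> the inner product vanishes, so membership only
      constrains the residual; the positive factor \<open>1 - \<eta>\<close> then forces it to be
      zero.\<close>
    have "x \<in> separating_halfspace F F' y \<eta> x \<longleftrightarrow> (1 - \<eta>) * (norm ?r)\<^sup>2 \<le> 0"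
      unfolding separating_halfspace_def mem_Collect_eq mult_minus_left by simp
    also have "\<dots> \<longleftrightarrow> (norm ?r)\<^sup>2 \<le> 0"
      using \<eta> by (intro mult_le_cancel_left_pos[of "1 - \<eta>" _ 0, simplified]) simp
    also have "\<dots> \<longleftrightarrow> F x = y"
      by (simp add: residual_def)
    finally show ?thesis .
  qed
  ultimately show ?thesis
    using ineq by blast
qed

end
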